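(* For all $\mathbf u,\mathbf v\in\mathcal U$: $$Q(\mathbf u,\mathbf u)=0,$$ and $$Q(\mathbf u,\mathbf v)=1\quad\text{if and only if the spheres }\langle\mathbf u\rangle\text{ and }\langle\mathbf v\rangle\text{ are tangent.}$$
   Context: Let $Q$ be the bilinear form on $\mathbb R^4$ given by $Q(\mathbf u,\mathbf v):=(\mathbf u\cdot\mathbf 1)(\mathbf v\cdot\mathbf 1)-\mathbf u\cdot\mathbf v$, where $\mathbf 1=(1,1,1,1)$. Let $$\mathcal U:=\{(a,b,c,d)\in\mathbb R^4:(a+b+c+d)^2=a^2+b^2+c^2+d^2,\ a+b+c>0\}.$$ Identify $\mathbb R^3$ with $\mathbb C\times\mathbb R$; for $z\in\mathbb C$, $r>0$, $S(z,r)$ is the sphere with center $(z,r)$ and radius $r$. Let $\omega=(-1+i\sqrt3)/2$. For real $a,b,c$ with $a+b+c>0$ put $$\langle a,b,c\rangle:=S\left(\frac{b+c(1+\omega)}{a+b+c},\frac1{2(a+b+c)}\right)$$ (i.e. the point of tangency has projective barycentric coordinates $(a,b,c)$ with respect to the equilateral triangle $0,1,1+\omega$). For $\mathbf u=(a,b,c,d)\in\mathcal U$, $\langle\mathbf u\rangle:=\langle a,b,c\rangle$. Two spheres $S(z,r)$ and $S(w,s)$ with $z\ne w$ are tangent iff $|z-w|^2=4rs$; a sphere is not considered tangent to itself. *)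

theory Defs
  imports "HOL-Analysis.Analysis"
begin

definition Q :: "real ^ 4 \<Rightarrow> real ^ 4 \<Rightarrow> real" where
  "Q u v = (u \<bullet> 1) * (v \<bullet> 1) - u \<bullet> v"

definition U :: "(real ^ 4) set" where
  "U = {u. (u$1 + u$2 + u$3 + u$4)\<^sup>2 = (u$1)\<^sup>2 + (u$2)\<^sup>2 + (u$3)\<^sup>2 + (u$4)\<^sup>2
         \<and> u$1 + u$2 + u$3 > 0}"

definition omega :: complex where
  "omega = (- 1 + \<i> * complex_of_real (sqrt 3)) / 2"

(* The distance on the product type complex * real is the Euclidean one, so this is
   a round 2-sphere in 3-space; it touches the plane complex * {0} at (z, 0). *)
definition S :: "complex \<Rightarrow> real \<Rightarrow> (complex \<times> real) set" where
  "S z r = sphere (z, r) r"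

definition bary_sphere :: "real \<Rightarrow> real \<Rightarrow> real \<Rightarrow> (complex \<times> real) set"
    ("\<langle>_,/ _,/ _\<rangle>") where
  "\<langle>a, b, c\<rangle> =
     S ((complex_of_real b + complex_of_real c * (1 + omega)) / complex_of_real (a + b + c))
       (1 / (2 * (a + b + c)))"

definition vec_sphere :: "real ^ 4 \<Rightarrow> (complex \<times> real) set" ("\<langle>_\<rangle>") where
  "\<langle>u\<rangle> = \<langle>u$1, u$2, u$3\<rangle>"

(* Two spheres are tangent when they meet in exactly one point. The condition z \<noteq> w
   excludes S z r and S z s with r \<noteq> s, where one sphere lies inside the other and touches
   it at (z, 0); it also excludes a sphere and itself. The lemma tangent_S_iff shows that
   this is the condition |z - w|^2 = 4 r s. *)
definition tangent :: "(complex \<times> real) set \<Rightarrow> (complex \<times> real) set \<Rightarrow> bool" where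
  "tangent A B \<longleftrightarrow>
     (\<exists>z r w s. r > 0 \<and> s > 0 \<and> z \<noteq> w \<and> A = S z r \<and> B = S w s \<and> (\<exists>p. A \<inter> B = {p}))"

lemma mem_S_iff:
  assumes "r > 0"
  shows "(x, t) \<in> S z r \<longleftrightarrow> (cmod (x - z))\<^sup>2 + t\<^sup>2 = 2 * r * t"
proof -
  have "(x, t) \<in> S z r \<longleftrightarrow> sqrt ((dist z x)\<^sup>2 + (dist r t)\<^sup>2) = r"
    by (simp add: S_def dist_Pair_Pair)
  also have "\<dots> \<longleftrightarrow> (dist z x)\<^sup>2 + (dist r t)\<^sup>2 = r\<^sup>2"
    using assms by (metis abs_of_pos real_sqrt_abs real_sqrt_eq_iff)
  also have "\<dots> \<longleftrightarrow> (cmod (x - z))\<^sup>2 + t\<^sup>2 = 2 * r * t"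
    by (simp add: dist_norm norm_minus_commute power2_diff algebra_simps)
  finally show ?thesis .
qed

lemma S_eq_iff:
  assumes "r > 0" "s > 0"
  shows "S z r = S w s \<longleftrightarrow> z = w \<and> r = s"
proof
  assume eq: "S z r = S w s"
  have "(z, 0) \<in> S z r" using assms by (simp add: mem_S_iff)
  then have "(z, 0) \<in> S w s" using eq by simp
  then have zw: "z = w" using assms by (simp add: mem_S_iff)
  have "(z, 2 * r) \<in> S z r" using assms by (simp add: mem_S_iff power2_eq_square)
  then have "(z, 2 * r) \<in> S w s" using eq by simp
  then have "r = s" using assms zw by (simp add: mem_S_iff power2_eq_square)
  with zw show "z = w \<and> r = s" by simp
qed simp

lemma S_inter_singleton_iff:
  assumes "r > 0" "s > 0" "z \<noteq> w"
  shows "(\<exists>p. S z r \<inter> S w s = {p}) \<longleftrightarrow> (cmod (z - w))\<^sup>2 = 4 * r * s"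
proof -
  define x where "x = (z, r)"
  define v where "v = (w, s) - x"
  have vx: "(w, s) = x + v" by (simp add: v_def)
  have v: "v \<bullet> v = (cmod (z - w))\<^sup>2 + (r - s)\<^sup>2"
    by (simp add: v_def x_def inner_prod_def power2_norm_eq_inner
        norm_minus_commute[of z w] flip: power2_eq_square) (simp add: power2_commute)
  have dz: "(cmod (z - w))\<^sup>2 > 0" using assms by simp
  have v0: "v \<bullet> v > 0" unfolding v using dz by (simp add: add_pos_nonneg)
  have mem: "x + q \<in> S z r \<inter> S w s \<longleftrightarrow> norm q = r \<and> norm (v - q) = s" for q
    by (simp add: S_def vx dist_norm flip: x_def)
  show ?thesis
  proof
    assume "\<exists>p. S z r \<inter> S w s = {p}"
    then obtain p where p: "S z r \<inter> S w s = {p}" ..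
    define q where "q = p - x"
    have q: "norm q = r" "norm (v - q) = s" using p mem[of q] by (auto simp: q_def)
    define t where "t = (q \<bullet> v) / (v \<bullet> v)"
    define q' where "q' = (2 * t) *\<^sub>R v - q"
    have tv: "t * (v \<bullet> v) = q \<bullet> v" using v0 by (simp add: t_def)
    have q'q': "q' \<bullet> q' = q \<bullet> q"
    proof -
      have "q' \<bullet> q' = 4 * t * (t * (v \<bullet> v)) - 4 * t * (q \<bullet> v) + q \<bullet> q"
        by (simp add: q'_def inner_diff inner_commute algebra_simps)
      then show ?thesis by (simp add: tv)
    qed
    have q'v: "q' \<bullet> v = q \<bullet> v"
      using tv by (simp add: q'_def inner_diff)
    have "norm q' = r" using q'q' q by (simp add: norm_eq_sqrt_inner)
    moreover have "norm (v - q') = norm (v - q)"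
      unfolding norm_eq_sqrt_inner using q'q' q'v by (simp add: inner_diff inner_commute)
    ultimately have "x + q' \<in> S z r \<inter> S w s" using mem q by simp
    then have "q' = q" using p by (auto simp: q_def)
    then have "2 *\<^sub>R q = 2 *\<^sub>R (t *\<^sub>R v)" by (simp add: q'_def algebra_simps scaleR_2)
    then have qt: "q = t *\<^sub>R v" by (metis scaleR_cancel_left zero_neq_numeral)
    then have vq: "v - q = (1 - t) *\<^sub>R v" by (simp add: algebra_simps)
    have r: "\<bar>t\<bar> * norm v = r" and s: "\<bar>1 - t\<bar> * norm v = s" using q qt vq by auto
    consider "t < 0" | "0 \<le> t" "t \<le> 1" | "t > 1" by linarith
    then have "norm v = r + s \<or> norm v = \<bar>r - s\<bar>"
    proof cases
      case 1 then have "norm v = s - r" using r s by (simp add: algebra_simps)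
      then show ?thesis using norm_ge_zero[of v] by linarith
    next
      case 2 then show ?thesis using r s by (simp add: algebra_simps)
    next
      case 3 then have "norm v = r - s" using r s by (simp add: algebra_simps)
      then show ?thesis using norm_ge_zero[of v] by linarith
    qed
    then have "v \<bullet> v = (r + s)\<^sup>2 \<or> v \<bullet> v = (r - s)\<^sup>2"
      by (auto simp flip: power2_norm_eq_inner)
    then show "(cmod (z - w))\<^sup>2 = 4 * r * s"
      using v dz by (auto simp: power2_eq_square algebra_simps)
  next
    assume "(cmod (z - w))\<^sup>2 = 4 * r * s"
    then have "(norm v)\<^sup>2 = (r + s)\<^sup>2"
      by (simp add: power2_norm_eq_inner v) (simp add: power2_eq_square algebra_simps)
    then have nv: "norm v = r + s" using assms by (simp add: power2_eq_iff_nonneg)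
    define q where "q = (r / (r + s)) *\<^sub>R v"
    have "v - q = (1 - r / (r + s)) *\<^sub>R v" by (simp add: q_def algebra_simps)
    then have vq: "v - q = (s / (r + s)) *\<^sub>R v" using assms by (simp add: field_simps)
    have "norm q = r" using assms nv by (simp add: q_def)
    moreover have "norm (v - q) = s" using assms nv by (simp add: vq)
    ultimately have "x + q \<in> S z r \<inter> S w s" using mem by simp
    moreover have "p = x + q" if "p \<in> S z r \<inter> S w s" for p
    proof -
      define y where "y = p - x"
      have y: "norm y = r" "norm (v - y) = s" using that mem[of y] by (auto simp: y_def)
      have "norm (y + (v - y)) = norm y + norm (v - y)" using y nv by simp
      then have "r *\<^sub>R (v - y) = s *\<^sub>R y" unfolding norm_triangle_eq using y by simp
      then have "(r + s) *\<^sub>R y = r *\<^sub>R v" by (simp add: algebra_simps)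
      then have "(1 / (r + s)) *\<^sub>R (r + s) *\<^sub>R y = (1 / (r + s)) *\<^sub>R r *\<^sub>R v" by (rule arg_cong)
      then have "y = q" using assms by (simp add: q_def)
      then show ?thesis by (metis y_def add.commute diff_add_cancel)
    qed
    ultimately show "\<exists>p. S z r \<inter> S w s = {p}" by blast
  qed
qed

lemma tangent_S_iff:
  assumes "r > 0" "s > 0"
  shows "tangent (S z r) (S w s) \<longleftrightarrow> z \<noteq> w \<and> (cmod (z - w))\<^sup>2 = 4 * r * s"
  unfolding tangent_def using assms S_eq_iff S_inter_singleton_iff by metis

end

theory Submission imports Defs begin

text \<open>
  The whole statement follows from one identity: if \<open>\<sigma> = a + b + c\<close> and \<open>z\<close> is the point of
  tangency of \<open>\<langle>u\<rangle>\<close> with the plane, and \<open>\<tau>\<close>, \<open>w\<close> are the same data for \<open>v\<close>, then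
  \<open>Q u v = \<sigma> \<tau> |z - w|\<^sup>2\<close> on \<open>U\<close> (lemma \<open>Q_eq_dist_tangency_points\<close>). The radii are
  \<open>1 / (2 \<sigma>)\<close> and \<open>1 / (2 \<tau>)\<close>, so \<open>Q u v = 1\<close> says exactly that \<open>|z - w|\<^sup>2\<close> is four times the
  product of the radii, and it forces \<open>z \<noteq> w\<close>. The identity with \<open>v = u\<close> gives \<open>Q u u = 0\<close>.

  The identity holds because \<open>U\<close> is, up to the scale \<open>\<sigma>\<close>, a paraboloid over the plane. If \<open>z\<close> has
  oblique coordinates \<open>(x, y)\<close> with respect to \<open>1\<close> and \<open>1 + \<omega>\<close>, then
  \<open>u = \<sigma> (1 - x - y, x, y, |z|\<^sup>2 - x - y)\<close> (lemma \<open>U_paraboloid\<close>): the equation of \<open>U\<close> is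
  linear in the last entry, because the squares of that entry cancel. On two such
  vectors the bilinear form \<open>Q\<close> polarises the squared distance.
\<close>

definition half_curvature :: "real ^ 4 \<Rightarrow> real" where
  "half_curvature u = u$1 + u$2 + u$3"

definition tangency_point :: "real ^ 4 \<Rightarrow> complex" where
  "tangency_point u =
     (complex_of_real (u$2) + complex_of_real (u$3) * (1 + omega)) / complex_of_real (half_curvature u)"

lemma vec_sphere_eq_S: "\<langle>u\<rangle> = S (tangency_point u) (1 / (2 * half_curvature u))"
  by (simp add: vec_sphere_def bary_sphere_def tangency_point_def half_curvature_def)

lemma half_curvature_pos: "u \<in> U \<Longrightarrow> half_curvature u > 0"
  by (simp add: U_def half_curvature_def)

text \<open>The vectors \<open>1\<close> and \<open>1 + \<omega>\<close> are unit vectors at an angle of 60 degrees, whence the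
  mixed term with coefficient \<open>1\<close>.\<close>

lemma cmod_oblique_coordinates:
  "(cmod (complex_of_real x + complex_of_real y * (1 + omega)))\<^sup>2 = x\<^sup>2 + x * y + y\<^sup>2"
proof -
  have "(x + y / 2)\<^sup>2 + (y * sqrt 3 / 2)\<^sup>2 = x\<^sup>2 + x * y + y\<^sup>2"
    by (simp add: power_divide power_mult_distrib) (simp add: power2_eq_square field_simps)
  then show ?thesis
    by (simp add: omega_def cmod_power2 field_simps)
qed

lemma tangency_point_oblique:
  "tangency_point u =
     complex_of_real (u$2 / half_curvature u) + complex_of_real (u$3 / half_curvature u) * (1 + omega)"
  by (simp add: tangency_point_def add_divide_distrib)

lemma U_paraboloid:
  assumes "u \<in> U"
  defines "\<sigma> \<equiv> half_curvature u"
  defines "x \<equiv> u$2 / \<sigma>" and "y \<equiv> u$3 / \<sigma>"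
  shows "u$1 = \<sigma> * (1 - x - y)" "u$2 = \<sigma> * x" "u$3 = \<sigma> * y"
    "u$4 = \<sigma> * (x\<^sup>2 + x * y + y\<^sup>2 - x - y)"
proof -
  have \<sigma>: "\<sigma> > 0" using assms by (simp add: half_curvature_pos)
  show 2: "u$2 = \<sigma> * x" and 3: "u$3 = \<sigma> * y" using \<sigma> by (simp_all add: x_def y_def)
  have "u$1 = \<sigma> - u$2 - u$3" by (simp add: \<sigma>_def half_curvature_def)
  then show 1: "u$1 = \<sigma> * (1 - x - y)" by (simp add: 2 3 algebra_simps)
  have "(u$1 + u$2 + u$3 + u$4)\<^sup>2 = (u$1)\<^sup>2 + (u$2)\<^sup>2 + (u$3)\<^sup>2 + (u$4)\<^sup>2"
    using assms by (simp add: U_def)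
  then have "(2 * \<sigma>) * u$4 = (2 * \<sigma>) * (\<sigma> * (x\<^sup>2 + x * y + y\<^sup>2 - x - y))"
    unfolding 1 2 3 by (simp add: power2_eq_square algebra_simps)
  then show "u$4 = \<sigma> * (x\<^sup>2 + x * y + y\<^sup>2 - x - y)" using \<sigma> by simp
qed

lemma Q_coordinates:
  "Q u v = (u$1 + u$2 + u$3 + u$4) * (v$1 + v$2 + v$3 + v$4)
     - (u$1 * v$1 + u$2 * v$2 + u$3 * v$3 + u$4 * v$4)"
  by (simp add: Q_def inner_vec_def sum_4)

lemma Q_eq_dist_tangency_points:
  assumes "u \<in> U" "v \<in> U"
  shows "Q u v = half_curvature u * half_curvature v * (cmod (tangency_point u - tangency_point v))\<^sup>2"
proof -
  define \<sigma> x y where "\<sigma> = half_curvature u" and "x = u$2 / \<sigma>" and "y = u$3 / \<sigma>"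
  define \<tau> x' y' where "\<tau> = half_curvature v" and "x' = v$2 / \<tau>" and "y' = v$3 / \<tau>"
  note u = U_paraboloid[OF assms(1), folded \<sigma>_def, folded x_def y_def]
  note v = U_paraboloid[OF assms(2), folded \<tau>_def, folded x'_def y'_def]
  have "tangency_point u - tangency_point v =
      complex_of_real (x - x') + complex_of_real (y - y') * (1 + omega)"
    by (simp add: tangency_point_oblique \<sigma>_def x_def y_def \<tau>_def x'_def y'_def algebra_simps)
  then have "(cmod (tangency_point u - tangency_point v))\<^sup>2 =
      (x - x')\<^sup>2 + (x - x') * (y - y') + (y - y')\<^sup>2"
    by (simp only: cmod_oblique_coordinates)
  moreover have "Q u v = \<sigma> * \<tau> * ((x - x')\<^sup>2 + (x - x') * (y - y') + (y - y')\<^sup>2)"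
    unfolding Q_coordinates u v by algebra
  ultimately show ?thesis by (simp add: \<sigma>_def \<tau>_def)
qed

theorem theorem3p4:
  fixes u v :: "real ^ 4"
  assumes "u \<in> U" and "v \<in> U"
  shows "Q u u = 0 \<and> (Q u v = 1 \<longleftrightarrow> tangent \<langle>u\<rangle> \<langle>v\<rangle>)"
proof
  show "Q u u = 0" using assms by (simp add: Q_eq_dist_tangency_points)
  define D where "D = (cmod (tangency_point u - tangency_point v))\<^sup>2"
  have pos: "half_curvature u > 0" "half_curvature v > 0" using assms by (simp_all add: half_curvature_pos)
  have Q: "Q u v = half_curvature u * half_curvature v * D"
    using assms by (simp add: Q_eq_dist_tangency_points D_def)
  have "tangent \<langle>u\<rangle> \<langle>v\<rangle> \<longleftrightarrow> tangency_point u \<noteq> tangency_point v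
      \<and> D = 4 * (1 / (2 * half_curvature u)) * (1 / (2 * half_curvature v))"
    unfolding vec_sphere_eq_S D_def using pos by (intro tangent_S_iff) simp_all
  also have "\<dots> \<longleftrightarrow> D \<noteq> 0 \<and> half_curvature u * half_curvature v * D = 1"
    using pos by (auto simp: D_def field_simps)
  also have "\<dots> \<longleftrightarrow> Q u v = 1" by (auto simp: Q)
  finally show "Q u v = 1 \<longleftrightarrow> tangent \<langle>u\<rangle> \<langle>v\<rangle>" by blast
qed

end
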